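(* Every weakly threshold graph is a split graph.
   Context: Graphs are finite and simple, with at least one vertex. For a degree sequence $d=(d_1,\dots,d_n)$ (terms in nonincreasing order) put $m(d)=\max\{i : d_i\ge i-1\}$ and, for $1\le k\le m(d)$, $\Delta_k(d)=k(k-1)+\sum_{i>k}\min\{k,d_i\}-\sum_{i=1}^k d_i$. A degree sequence $d$ is a weakly threshold sequence if $\Delta_k(d)\le 1$ for all $k\in\{1,\dots,m(d)\}$, and a weakly threshold graph is a graph whose degree sequence is weakly threshold. A graph is split if its vertex set can be partitioned into two (possibly empty) sets, one of which is a clique and the other an independent set. *)

theory Defs
  imports "HOL-Library.Multiset"
begin

definition simple_graph :: "'a set \<Rightarrow> 'a set set \<Rightarrow> bool" where
  "simple_graph V E \<longleftrightarrow> finite V \<and> V \<noteq> {} \<and> (\<forall>e\<in>E. e \<subseteq> V \<and> card e = 2)"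

definition vertex_degree :: "'a set set \<Rightarrow> 'a \<Rightarrow> nat" where
  "vertex_degree E v = card {e \<in> E. v \<in> e}"

definition degree_sequence :: "'a set \<Rightarrow> 'a set set \<Rightarrow> nat list" where
  "degree_sequence V E =
     rev (sorted_list_of_multiset (image_mset (vertex_degree E) (mset_set V)))"

text \<open>
  The sequence notions below take nonincreasing lists of natural numbers. Their terms are
  numbered from 1, so the term with index \<open>i\<close> is \<open>d ! (i - 1)\<close>, for \<open>1 \<le> i \<le> length d\<close>.
\<close>

definition seq_term :: "nat list \<Rightarrow> nat \<Rightarrow> nat" where
  "seq_term d i = d ! (i - 1)"

definition seq_m :: "nat list \<Rightarrow> nat" where
  "seq_m d = Max {i. 1 \<le> i \<and> i \<le> length d \<and> seq_term d i \<ge> i - 1}"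

text \<open>Integer-valued, so that the final subtraction is not truncated.\<close>

definition seq_Delta :: "nat list \<Rightarrow> nat \<Rightarrow> int" where
  "seq_Delta d k =
     int k * (int k - 1) + (\<Sum>i=k+1..length d. int (min k (seq_term d i)))
       - (\<Sum>i=1..k. int (seq_term d i))"

definition weakly_threshold_sequence :: "nat list \<Rightarrow> bool" where
  "weakly_threshold_sequence d \<longleftrightarrow> (\<forall>k\<in>{1..seq_m d}. seq_Delta d k \<le> 1)"

definition weakly_threshold_graph :: "'a set \<Rightarrow> 'a set set \<Rightarrow> bool" where
  "weakly_threshold_graph V E \<longleftrightarrow>
     simple_graph V E \<and> weakly_threshold_sequence (degree_sequence V E)"

definition clique :: "'a set set \<Rightarrow> 'a set \<Rightarrow> bool" where
  "clique E K \<longleftrightarrow> (\<forall>u\<in>K. \<forall>v\<in>K. u \<noteq> v \<longrightarrow> {u, v} \<in> E)"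

definition independent_set :: "'a set set \<Rightarrow> 'a set \<Rightarrow> bool" where
  "independent_set E I \<longleftrightarrow> (\<forall>u\<in>I. \<forall>v\<in>I. {u, v} \<notin> E)"

definition split_graph :: "'a set \<Rightarrow> 'a set set \<Rightarrow> bool" where
  "split_graph V E \<longleftrightarrow>
     simple_graph V E \<and>
     (\<exists>K I. K \<union> I = V \<and> K \<inter> I = {} \<and> clique E K \<and> independent_set E I)"

end

theory Submission imports Defs
begin

text \<open>
  The whole statement is carried by the single inequality \<open>\<Delta>\<^sub>m \<le> 1\<close> for the last
  index \<open>m = m(d)\<close>. List the vertices by nonincreasing degree, let \<open>A\<close> be the first \<open>m\<close> of
  them and \<open>B\<close> the others. By maximality of \<open>m\<close> all degrees in \<open>B\<close> are below \<open>m\<close>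
  (\<open>seq_term_less_seq_m\<close>), so the minima in \<open>\<Delta>\<^sub>m\<close> disappear and
  \<open>\<Delta>\<^sub>m = m (m - 1) + (\<Sum>v\<in>B. deg v) - (\<Sum>v\<in>A. deg v)\<close>.
  The edges between \<open>A\<close> and \<open>B\<close> are counted once in each of the two sums and cancel. What
  remains is the number of ordered pairs of distinct nonadjacent vertices of \<open>A\<close> plus the
  number of ordered pairs of adjacent vertices of \<open>B\<close> (\<open>degree_difference_eq_card_defects\<close>).
  Such pairs come with their reversals, so this number cannot be 1. Hence it is 0, which says
  that \<open>A\<close> is a clique and \<open>B\<close> is independent.
\<close>

lemma simple_graph_no_loop:
  assumes "simple_graph V E"
  shows "{v, v} \<notin> E"
proof
  assume "{v, v} \<in> E"
  then have "card {v, v} = 2"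
    using assms unfolding simple_graph_def by blast
  then show False by simp
qed

text \<open>
  Summing indicators over all possible neighbours makes a degree split along any partition of
  the vertex set.
\<close>

lemma vertex_degree_eq_sum_adjacent:
  assumes "simple_graph V E"
  shows "int (vertex_degree E v) = (\<Sum>u\<in>V. of_bool ({v, u} \<in> E))"
proof -
  have fin: "finite V" and edge: "\<And>e. e \<in> E \<Longrightarrow> e \<subseteq> V \<and> card e = 2"
    using assms unfolding simple_graph_def by auto
  have "{e \<in> E. v \<in> e} = (\<lambda>u. {v, u}) ` {u \<in> V. {v, u} \<in> E}"
  proof (intro equalityI subsetI)
    fix e assume e: "e \<in> {e \<in> E. v \<in> e}"
    then obtain x y where "e = {x, y}" by (auto dest!: edge simp: card_2_iff)
    with e have "e = {v, x} \<or> e = {v, y}" by auto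
    with e edge show "e \<in> (\<lambda>u. {v, u}) ` {u \<in> V. {v, u} \<in> E}" by blast
  qed auto
  moreover have "inj_on (\<lambda>u. {v, u}) {u \<in> V. {v, u} \<in> E}"
    by (auto simp: inj_on_def doubleton_eq_iff)
  ultimately have "vertex_degree E v = card {u \<in> V. {v, u} \<in> E}"
    by (simp add: vertex_degree_def card_image)
  then show ?thesis
    using fin by (simp add: of_bool_def sum.If_cases Int_def)
qed

lemma degree_sequence_enumeration:
  assumes "finite V"
  obtains w where "bij_betw w {1..length (degree_sequence V E)} V"
    and "\<And>i. i \<in> {1..length (degree_sequence V E)} \<Longrightarrow>
            seq_term (degree_sequence V E) i = vertex_degree E (w i)"
proof -
  obtain xs where xs: "set xs = V" "distinct xs"
    using assms finite_distinct_list by blast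
  define vs where "vs = rev (sort_key (vertex_degree E) xs)"
  have vs: "set vs = V" "distinct vs"
    using xs by (simp_all add: vs_def)
  have "image_mset (vertex_degree E) (mset_set V) = mset (map (vertex_degree E) xs)"
    using xs by (metis mset_map mset_set_set)
  then have "degree_sequence V E = rev (sort (map (vertex_degree E) xs))"
    by (simp only: degree_sequence_def sorted_list_of_multiset_mset)
  also have "sort (map (vertex_degree E) xs)
      = map (vertex_degree E) (sort_key (vertex_degree E) xs)"
    by (rule properties_for_sort) simp_all
  finally have d: "degree_sequence V E = map (vertex_degree E) vs"
    by (simp add: vs_def rev_map)
  have "bij_betw (\<lambda>i. vs ! (i - 1)) {1..length vs} V"
  proof (rule bij_betw_trans[where f = "\<lambda>i. i - 1" and g = "(!) vs", unfolded comp_def])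
    show "bij_betw (\<lambda>i. i - 1) {1..length vs} {..<length vs}"
      by (rule bij_betw_byWitness[where f' = Suc]) auto
    show "bij_betw ((!) vs) {..<length vs} V"
      using vs by (simp add: bij_betw_nth)
  qed
  then show ?thesis
    by (intro that[of "\<lambda>i. vs ! (i - 1)"]) (auto simp: d seq_term_def)
qed

lemma seq_term_degree_sequence_antimono:
  assumes "1 \<le> i" "i \<le> j" "j \<le> length (degree_sequence V E)"
  shows "seq_term (degree_sequence V E) j \<le> seq_term (degree_sequence V E) i"
proof -
  have "sorted (rev (degree_sequence V E))"
    by (simp add: degree_sequence_def)
  then show ?thesis
    unfolding seq_term_def using assms by (intro sorted_rev_nth_mono) auto
qed

lemma seq_m_bounds:
  assumes "d \<noteq> []"
  shows "1 \<le> seq_m d" "seq_m d \<le> length d"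
proof -
  let ?S = "{i. 1 \<le> i \<and> i \<le> length d \<and> seq_term d i \<ge> i - 1}"
  have "1 \<in> ?S"
    using assms by (simp add: Suc_le_eq)
  then have "seq_m d \<in> ?S"
    unfolding seq_m_def by (intro Max_in) auto
  then show "1 \<le> seq_m d" "seq_m d \<le> length d" by auto
qed

text \<open>
  The term with index \<open>m(d) + 1\<close> violates the condition that defines \<open>m(d)\<close>, so it is below
  \<open>m(d)\<close>; the later terms are no larger.
\<close>

lemma seq_term_less_seq_m:
  assumes antimono: "\<And>i j. 1 \<le> i \<Longrightarrow> i \<le> j \<Longrightarrow> j \<le> length d \<Longrightarrow> seq_term d j \<le> seq_term d i"
    and "seq_m d < i" "i \<le> length d"
  shows "seq_term d i < seq_m d"
proof -
  let ?S = "{i. 1 \<le> i \<and> i \<le> length d \<and> seq_term d i \<ge> i - 1}"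
  have "seq_m d + 1 \<notin> ?S"
  proof
    assume "seq_m d + 1 \<in> ?S"
    then have "seq_m d + 1 \<le> seq_m d"
      unfolding seq_m_def by (intro Max_ge) auto
    then show False by simp
  qed
  then have "seq_term d (seq_m d + 1) < seq_m d"
    using assms(2,3) by auto
  moreover have "seq_term d i \<le> seq_term d (seq_m d + 1)"
    using assms(2,3) by (intro antimono) auto
  ultimately show ?thesis by simp
qed

text \<open>
  Pairs are ordered because a degree sum counts every edge inside the set from both ends; the
  edges between \<open>A\<close> and \<open>B\<close> contribute equally to both degree sums.
\<close>

lemma degree_difference_eq_card_defects:
  assumes G: "simple_graph V E" and V: "V = A \<union> B" "A \<inter> B = {}"
  shows "int (card A) * (int (card A) - 1)
           + (\<Sum>v\<in>B. int (vertex_degree E v)) - (\<Sum>v\<in>A. int (vertex_degree E v))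
         = int (card {(u, v) \<in> A \<times> A. u \<noteq> v \<and> {u, v} \<notin> E})
           + int (card {(u, v) \<in> B \<times> B. {u, v} \<in> E})"
proof -
  define adj :: "'a \<Rightarrow> 'a \<Rightarrow> int" where "adj u v = of_bool ({u, v} \<in> E)" for u v
  define e where "e X Y = (\<Sum>u\<in>X. \<Sum>v\<in>Y. adj u v)" for X Y
  have fin: "finite A" "finite B"
    using G V unfolding simple_graph_def by auto
  have degree_adj: "int (vertex_degree E v) = (\<Sum>u\<in>V. adj v u)" for v
    unfolding adj_def by (rule vertex_degree_eq_sum_adjacent[OF G])
  have deg_sum: "(\<Sum>v\<in>X. int (vertex_degree E v)) = e X A + e X B" for X
    using fin V by (simp add: degree_adj sum.union_disjoint sum.distrib e_def)
  have adj_commute: "adj u v = adj v u" for u v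
    by (simp add: adj_def insert_commute)
  have cross: "e A B = e B A"
    unfolding e_def by (subst sum.swap) (simp add: adj_commute)
  have card_pairs: "int (card {(u, v) \<in> X \<times> X. P u v}) = (\<Sum>u\<in>X. \<Sum>v\<in>X. of_bool (P u v))"
    if "finite X" for X :: "'a set" and P
  proof -
    have "(\<Sum>u\<in>X. \<Sum>v\<in>X. of_bool (P u v)) = (\<Sum>p\<in>X \<times> X. of_bool (P (fst p) (snd p)) :: int)"
      by (simp add: sum.cartesian_product case_prod_beta)
    also have "\<dots> = int (card (X \<times> X \<inter> {p. P (fst p) (snd p)}))"
      using that by (simp add: of_bool_def sum.If_cases)
    also have "X \<times> X \<inter> {p. P (fst p) (snd p)} = {(u, v) \<in> X \<times> X. P u v}"
      by auto
    finally show ?thesis by simp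
  qed
  have "(\<Sum>v\<in>A. of_bool (u \<noteq> v)) = int (card A) - 1" if "u \<in> A" for u
  proof -
    have "(\<Sum>v\<in>A. of_bool (u \<noteq> v)) = (\<Sum>v\<in>A. 1 - (if u = v then 1 else 0) :: int)"
      by (intro sum.cong) auto
    then show ?thesis
      using fin that by (simp add: sum_subtractf)
  qed
  then have "int (card A) * (int (card A) - 1) = (\<Sum>u\<in>A. \<Sum>v\<in>A. of_bool (u \<noteq> v))"
    by simp
  then have "int (card A) * (int (card A) - 1) - e A A
      = (\<Sum>u\<in>A. \<Sum>v\<in>A. of_bool (u \<noteq> v) - adj u v)"
    by (simp add: e_def sum_subtractf)
  also have "\<dots> = (\<Sum>u\<in>A. \<Sum>v\<in>A. of_bool (u \<noteq> v \<and> {u, v} \<notin> E))"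
    using simple_graph_no_loop[OF G] by (intro sum.cong) (auto simp: adj_def)
  finally show ?thesis
    unfolding card_pairs[OF fin(1)] card_pairs[OF fin(2)] deg_sum cross
    by (simp only: e_def adj_def)
qed

lemma symmetric_relation_card_le_1_empty:
  assumes "finite R" "card R \<le> 1"
    and sym: "\<And>x y. (x, y) \<in> R \<Longrightarrow> (y, x) \<in> R" and irrefl: "\<And>x. (x, x) \<notin> R"
  shows "R = {}"
proof (rule ccontr)
  assume "R \<noteq> {}"
  then obtain x y where xy: "(x, y) \<in> R" by auto
  have "\<forall>p\<in>R. \<forall>q\<in>R. p = q"
    using assms(2) card_le_Suc0_iff_eq[OF assms(1)] by simp
  then have "x = y"
    using xy sym[OF xy] by blast
  then show False
    using xy irrefl by simp
qed

theorem theorem2p4: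
  fixes V :: "'a set" and E :: "'a set set"
  assumes "weakly_threshold_graph V E"
  shows "split_graph V E"
proof -
  define d where "d = degree_sequence V E"
  define n where "n = length d"
  define m where "m = seq_m d"
  have G: "simple_graph V E" and wt: "weakly_threshold_sequence d"
    using assms by (auto simp: weakly_threshold_graph_def d_def)
  have fin: "finite V" and "V \<noteq> {}"
    using G by (auto simp: simple_graph_def)
  obtain w where w: "bij_betw w {1..n} V"
    and deg: "\<And>i. i \<in> {1..n} \<Longrightarrow> seq_term d i = vertex_degree E (w i)"
    using degree_sequence_enumeration[OF fin, of E] unfolding d_def n_def by blast
  have "d \<noteq> []"
    using w \<open>V \<noteq> {}\<close> by (auto simp: n_def bij_betw_def)
  then have m: "1 \<le> m" "m \<le> n"
    using seq_m_bounds unfolding m_def n_def by auto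
  define A where "A = w ` {1..m}"
  define B where "B = w ` {m+1..n}"
  have split: "{1..n} = {1..m} \<union> {m+1..n}"
    using m by auto
  have inj: "inj_on w {1..n}" and onto: "w ` {1..n} = V"
    using w by (auto simp: bij_betw_def)
  have injA: "inj_on w {1..m}" and injB: "inj_on w {m+1..n}"
    using inj split by (auto intro: inj_on_subset)
  have V: "V = A \<union> B"
    using onto by (simp only: split image_Un A_def B_def)
  have disj: "A \<inter> B = {}"
    unfolding A_def B_def using m
    by (subst inj_on_image_Int[OF inj, symmetric]) auto
  have finA: "finite A" and finB: "finite B"
    by (simp_all add: A_def B_def)
  have cardA: "card A = m"
    using card_image[OF injA] by (simp add: A_def)
  have sumA: "(\<Sum>i=1..m. int (seq_term d i)) = (\<Sum>v\<in>A. int (vertex_degree E v))"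
    unfolding A_def using m by (subst sum.reindex[OF injA]) (simp add: deg)
  have "(\<Sum>i=m+1..n. int (min m (seq_term d i))) = (\<Sum>i=m+1..n. int (vertex_degree E (w i)))"
  proof (rule sum.cong[OF refl])
    fix i assume i: "i \<in> {m+1..n}"
    then have "seq_term d i < m"
      unfolding m_def n_def
      by (intro seq_term_less_seq_m) (auto simp: d_def intro: seq_term_degree_sequence_antimono)
    with i show "int (min m (seq_term d i)) = int (vertex_degree E (w i))"
      by (simp add: deg)
  qed
  then have sumB: "(\<Sum>i=m+1..n. int (min m (seq_term d i))) = (\<Sum>v\<in>B. int (vertex_degree E v))"
    unfolding B_def by (subst sum.reindex[OF injB]) simp
  define N where "N = {(u, v) \<in> A \<times> A. u \<noteq> v \<and> {u, v} \<notin> E}"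
  define M where "M = {(u, v) \<in> B \<times> B. {u, v} \<in> E}"
  have "seq_Delta d m \<le> 1"
    using wt m by (simp add: weakly_threshold_sequence_def m_def)
  moreover have "seq_Delta d m = int (card N) + int (card M)"
    using degree_difference_eq_card_defects[OF G V disj]
    unfolding seq_Delta_def n_def[symmetric] sumA sumB cardA N_def M_def .
  ultimately have cards: "card N \<le> 1" "card M \<le> 1"
    by linarith+
  have "N = {}"
  proof (rule symmetric_relation_card_le_1_empty)
    show "finite N"
      by (rule finite_subset[of _ "A \<times> A"]) (auto simp: N_def finA)
  qed (use cards in \<open>auto simp: N_def insert_commute\<close>)
  then have "clique E A"
    by (auto simp: clique_def N_def)
  have "M = {}"
  proof (rule symmetric_relation_card_le_1_empty)
    show "finite M"
      by (rule finite_subset[of _ "B \<times> B"]) (auto simp: M_def finB)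
  qed (use cards simple_graph_no_loop[OF G] in \<open>auto simp: M_def insert_commute\<close>)
  then have "independent_set E B"
    by (auto simp: independent_set_def M_def)
  with \<open>clique E A\<close> show ?thesis
    using G V disj unfolding split_graph_def by blast
qed

end
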